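(* Let $\mathcal{C}$ be an $[n,k,d]_q$ MDS code of distance $d\ge 5$, and let $\mathcal{V}^{(2)}$ be one of its cosets of weight $2$. Then, in terms of the value $B_{d-2}(\mathcal{V}^{(2)})$, the number $B_w(\mathcal{V}^{(2)})$ of weight $w$ vectors in $\mathcal{V}^{(2)}$ has the form: $$B_w(\mathcal{V}^{(2)})=0\ \text{ if } w\in\{0,1,\ldots,d-3\}\setminus\{2\},\qquad B_2(\mathcal{V}^{(2)})=1,$$ $$B_w(\mathcal{V}^{(2)})=A_w(\mathcal{C})-\Omega_w^{(0)}(n,d)+\Omega_w^{(2)}(n,d)+(-1)^{w-d}\binom{n-d+2}{n-w}B_{d-2}(\mathcal{V}^{(2)})\ \text{ if } w=d-1,d,\ldots,n.$$
   Context: An $[n,k,d]_q$ code is a $k$-dimensional $\mathbb{F}_q$-linear subspace of $\mathbb{F}_q^n$ with minimum Hamming distance $d$; it is MDS if $d=n-k+1$. A coset of $\mathcal{C}$ is a translate $\mathcal{C}+\mathbf{v}$, $\mathbf{v}\in\mathbb{F}_q^n$; the weight of a coset is the smallest Hamming weight of a vector in it. $A_w(\mathcal{C})$ is the number of codewords of Hamming weight $w$ in $\mathcal{C}$, and $B_w(\mathcal{V})$ is the number of vectors of Hamming weight $w$ in the coset $\mathcal{V}$. Notation: $\Omega_w^{(v)}(n,d)=(-1)^{w-d}\binom{n-v}{w-v}\binom{w-1-v}{d-2-v}$. *)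

theory Defs
  imports "HOL-Analysis.Analysis"
begin

text \<open>
  The field \<open>\<F>\<^sub>q\<close> is a type of class \<^class>\<open>field\<close> and \<^class>\<open>finite\<close>, and \<open>\<F>\<^sub>q\<^sup>n\<close> is
  \<open>'a ^ 'n\<close> with \<open>n = CARD('n)\<close>.  Subspaces and dimension are those of the interpretation
  \<open>vec\<close> of \<^locale>\<open>vector_space\<close>, whose scalar multiplication is \<open>(*s)\<close>.
\<close>

definition hamming_weight :: "'a::zero ^ 'n \<Rightarrow> nat" where
  "hamming_weight x = card {i. x $ i \<noteq> 0}"

definition hamming_dist :: "'a ^ 'n \<Rightarrow> 'a ^ 'n \<Rightarrow> nat" where
  "hamming_dist x y = card {i. x $ i \<noteq> y $ i}"

text \<open>A relation rather than a function: a code with at most one word has no minimum distance.\<close>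

definition has_min_dist :: "('a ^ 'n) set \<Rightarrow> nat \<Rightarrow> bool" where
  "has_min_dist C d \<longleftrightarrow>
     (\<exists>x\<in>C. \<exists>y\<in>C. x \<noteq> y \<and> hamming_dist x y = d) \<and>
     (\<forall>x\<in>C. \<forall>y\<in>C. x \<noteq> y \<longrightarrow> d \<le> hamming_dist x y)"

definition linear_code ::
  "nat \<Rightarrow> nat \<Rightarrow> nat \<Rightarrow> nat \<Rightarrow> ('a::{field,finite} ^ 'n) set \<Rightarrow> bool" where
  "linear_code n k d q C \<longleftrightarrow>
     CARD('n) = n \<and> CARD('a) = q \<and> vec.subspace C \<and> vec.dim C = k \<and> has_min_dist C d"

definition mds_code ::
  "nat \<Rightarrow> nat \<Rightarrow> nat \<Rightarrow> nat \<Rightarrow> ('a::{field,finite} ^ 'n) set \<Rightarrow> bool" where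
  "mds_code n k d q C \<longleftrightarrow> linear_code n k d q C \<and> d = n - k + 1"

definition cosets :: "('a::plus ^ 'n) set \<Rightarrow> ('a ^ 'n) set set" where
  "cosets C = {(\<lambda>c. c + v) ` C | v. True}"

definition coset_weight :: "('a::{zero,finite} ^ 'n) set \<Rightarrow> nat" where
  "coset_weight V = Min (hamming_weight ` V)"

text \<open>This is \<open>A\<^sub>w(C)\<close> when applied to a code and \<open>B\<^sub>w(V)\<close> when applied to a coset.\<close>

definition weight_count :: "('a::zero ^ 'n) set \<Rightarrow> nat \<Rightarrow> nat" where
  "weight_count S w = card {x \<in> S. hamming_weight x = w}"

text \<open>
  \<open>Omega v w n d\<close> is \<open>\<Omega>\<^sub>w\<^sup>(\<^sup>v\<^sup>)(n,d)\<close>.  The subtractions inside the binomial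
  coefficients are on natural numbers, so the definition is meaningful for
  \<open>v + 2 \<le> d\<close>, \<open>v + 1 \<le> w \<le> n\<close>.  The exponent may be negative (\<open>w = d - 1\<close>), hence
  the integer power.
\<close>

definition Omega :: "nat \<Rightarrow> nat \<Rightarrow> nat \<Rightarrow> nat \<Rightarrow> real" where
  "Omega v w n d =
     (-1) powi (int w - int d) * real ((n - v) choose (w - v)) * real ((w - 1 - v) choose (d - 2 - v))"

end

theory Submission
  imports Defs
begin

text \<open>
  Any \<open>k\<close> coordinates form an information set of an MDS code of dimension \<open>k\<close>, so for
  every set \<open>T\<close> of at most \<open>k\<close> coordinates a coset has exactly as many words vanishing on \<open>T\<close>
  as the code itself.  Summing over \<open>card T = j\<close>, the sums of \<open>(n - wt x) choose j\<close> over \<open>C\<close> and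
  over \<open>V\<close> agree for \<open>j \<le> k\<close>.  An alternating combination of these identities isolates one
  weight \<open>w \<ge> d - 1\<close>; only the weights \<open>0\<close> in \<open>C\<close> and \<open>2\<close>, \<open>d - 2\<close> in \<open>V\<close> contribute besides,
  and they give the two \<open>\<Omega>\<close> terms and the term with \<open>weight_count V (d - 2)\<close>.
\<close>

section \<open>Elementary facts on Hamming weight\<close>

lemma hamming_weight_le: "hamming_weight (x :: 'a::zero ^ 'n) \<le> CARD('n)"
  unfolding hamming_weight_def by (rule card_mono) auto

lemma card_zero_coordinates:
  "card {i. (x :: 'a::zero ^ 'n) $ i = 0} = CARD('n) - hamming_weight x"
proof -
  have "{i. x $ i = 0} = UNIV - {i. x $ i \<noteq> 0}" by auto
  then show ?thesis
    unfolding hamming_weight_def by (metis card_Diff_subset finite subset_UNIV)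
qed

lemma hamming_weight_eq_0_iff: "hamming_weight (x :: 'a::zero ^ 'n) = 0 \<longleftrightarrow> x = 0"
  unfolding hamming_weight_def by (auto simp: vec_eq_iff)

lemma hamming_weight_diff_le:
  "hamming_weight (x - y :: 'a::ab_group_add ^ 'n) \<le> hamming_weight x + hamming_weight y"
proof -
  have "{i. (x - y) $ i \<noteq> 0} \<subseteq> {i. x $ i \<noteq> 0} \<union> {i. y $ i \<noteq> 0}" by auto
  then have "card {i. (x - y) $ i \<noteq> 0} \<le> card ({i. x $ i \<noteq> 0} \<union> {i. y $ i \<noteq> 0})"
    by (intro card_mono) auto
  also have "\<dots> \<le> card {i. x $ i \<noteq> 0} + card {i. y $ i \<noteq> 0}"
    by (rule card_Un_le)
  finally show ?thesis unfolding hamming_weight_def .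
qed

lemma hamming_dist_eq_weight_diff:
  "hamming_dist x y = hamming_weight (x - y :: 'a::ab_group_add ^ 'n)"
  unfolding hamming_dist_def hamming_weight_def by simp

section \<open>Information sets of MDS codes\<close>

text \<open>The unit vectors indexed by \<open>T\<close> span this space. When
  \<open>card T = vec.dim C\<close>, the bound forces an injective linear image of \<open>C\<close>
  inside the space to fill it.\<close>

lemma dim_supported_le:
  fixes T :: "'n::finite set"
  shows "vec.dim {x :: 'a::field ^ 'n. \<forall>i. i \<notin> T \<longrightarrow> x $ i = 0} \<le> card T"
proof -
  let ?B = "(\<lambda>i. axis i 1 :: 'a ^ 'n) ` T"
  have "x \<in> vec.span ?B" if x: "\<forall>i. i \<notin> T \<longrightarrow> x $ i = 0" for x :: "'a ^ 'n"
  proof -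
    have "x = (\<Sum>i\<in>UNIV. x $ i *s axis i 1)"
      by (rule basis_expansion[symmetric])
    also have "\<dots> = (\<Sum>i\<in>T. x $ i *s axis i 1)"
      by (rule sum.mono_neutral_right) (use x in auto)
    also have "\<dots> \<in> vec.span ?B"
      by (intro vec.span_sum vec.span_scale vec.span_base) auto
    finally show ?thesis .
  qed
  then have "vec.dim {x :: 'a ^ 'n. \<forall>i. i \<notin> T \<longrightarrow> x $ i = 0} \<le> card ?B"
    by (intro vec.dim_le_card) auto
  also have "\<dots> \<le> card T" by (rule card_image_le) simp
  finally show ?thesis .
qed

text \<open>A word vanishing on \<open>dim C\<close> coordinates is too light to be a nonzero codeword, so the
  restriction of \<open>C\<close> to such a coordinate set is injective, hence onto.\<close>

lemma mds_interpolation: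
  fixes C :: "('a::{field,finite} ^ 'n) set"
  assumes sub: "vec.subspace C"
    and wt: "\<And>c. c \<in> C \<Longrightarrow> c \<noteq> 0 \<Longrightarrow> CARD('n) - vec.dim C < hamming_weight c"
    and T: "card T \<le> vec.dim C"
  obtains c where "c \<in> C" "\<And>i. i \<in> T \<Longrightarrow> c $ i = y $ i"
proof -
  have "vec.dim C \<le> CARD('n)"
    using vec.dim_subset[of C UNIV] vec_dim_card[where 'a = 'a and 'n = 'n] by simp
  then obtain T' :: "'n set" where T': "T \<subseteq> T'" "card T' = vec.dim C"
    using exists_subset_between[of T "vec.dim C" UNIV] T by auto
  \<comment> \<open>Restriction to \<open>T'\<close> is modelled as zeroing all other coordinates,
    so that \<open>P\<close> stays an endomorphism of the ambient space.\<close>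
  define P where "P x = (\<chi> i. if i \<in> T' then x $ i else 0)" for x :: "'a ^ 'n"
  define S where "S = {x :: 'a ^ 'n. \<forall>i. i \<notin> T' \<longrightarrow> x $ i = 0}"
  have lin: "Vector_Spaces.linear (*s) (*s) P"
    by unfold_locales (auto simp: P_def vec_eq_iff algebra_simps)
  have inj: "inj_on P C"
  proof (rule inj_onI, rule ccontr)
    fix a b assume ab: "a \<in> C" "b \<in> C" "P a = P b" "a \<noteq> b"
    have "T' \<subseteq> {i. (a - b) $ i = 0}"
    proof
      fix i assume "i \<in> T'"
      moreover have "P a $ i = P b $ i" using ab(3) by simp
      ultimately show "i \<in> {i. (a - b) $ i = 0}" by (simp add: P_def)
    qed
    then have "vec.dim C \<le> CARD('n) - hamming_weight (a - b)"
      using card_mono[of "{i. (a - b) $ i = 0}" T'] T' card_zero_coordinates[of "a - b"] by simp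
    moreover have "CARD('n) - vec.dim C < hamming_weight (a - b)"
      using ab by (intro wt vec.subspace_diff sub) auto
    ultimately show False using hamming_weight_le[of "a - b"] by linarith
  qed
  have "vec.dim (P ` C) = vec.dim C"
    by (rule vec.dim_image_eq[OF lin]) (simp add: vec.span_eq_iff[THEN iffD2, OF sub] inj)
  moreover have "P ` C \<subseteq> S" by (auto simp: P_def S_def)
  moreover have "vec.dim S \<le> vec.dim C" unfolding S_def T'(2)[symmetric] by (rule dim_supported_le)
  moreover have "vec.subspace S" by (auto simp: S_def vec.subspace_def)
  moreover have "vec.subspace (P ` C)" by (rule vec.linear_subspace_image[OF lin sub])
  ultimately have "P ` C = S" by (intro vec.subspace_dim_equal) auto
  moreover have "P y \<in> S" by (auto simp: P_def S_def)
  ultimately obtain c where c: "c \<in> C" "P c = P y" by (metis imageE)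
  show ?thesis
  proof
    fix i assume "i \<in> T"
    then have "i \<in> T'" using T' by auto
    moreover have "P c $ i = P y $ i" using c by simp
    ultimately show "c $ i = y $ i" by (simp add: P_def)
  qed (rule c)
qed

section \<open>Counting words by their zero coordinates\<close>

text \<open>Double counting of the pairs \<open>(x, T)\<close> in which \<open>T\<close> is a
  \<open>j\<close>-set of zero coordinates of \<open>x\<close>.\<close>

lemma sum_choose_zero_coordinates:
  fixes S :: "('a::{zero,finite} ^ 'n) set"
  shows "(\<Sum>x\<in>S. (CARD('n) - hamming_weight x) choose j) =
    (\<Sum>T | card T = j. card {x \<in> S. \<forall>i\<in>T. x $ i = 0})"
proof -
  have "(\<Sum>x\<in>S. (CARD('n) - hamming_weight x) choose j) =
      (\<Sum>x\<in>S. \<Sum>T | T \<in> {T. card T = j} \<and> (\<forall>i\<in>T. x $ i = 0). 1)"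
  proof (rule sum.cong)
    fix x :: "'a ^ 'n"
    have "(CARD('n) - hamming_weight x) choose j = card {T. T \<subseteq> {i. x $ i = 0} \<and> card T = j}"
      by (simp add: n_subsets card_zero_coordinates)
    also have "{T. T \<subseteq> {i. x $ i = 0} \<and> card T = j} =
        {T. T \<in> {T. card T = j} \<and> (\<forall>i\<in>T. x $ i = 0)}" by auto
    finally show "(CARD('n) - hamming_weight x) choose j =
        (\<Sum>T | T \<in> {T. card T = j} \<and> (\<forall>i\<in>T. x $ i = 0). 1)" by simp
  qed simp
  also have "\<dots> = (\<Sum>T | card T = j. \<Sum>x | x \<in> S \<and> (\<forall>i\<in>T. x $ i = 0). 1)"
    by (rule sum.swap_restrict) auto
  finally show ?thesis by simp
qed

lemma coset_sum_choose:
  fixes C :: "('a::{field,finite} ^ 'n) set"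
  assumes sub: "vec.subspace C"
    and wt: "\<And>c. c \<in> C \<Longrightarrow> c \<noteq> 0 \<Longrightarrow> CARD('n) - vec.dim C < hamming_weight c"
    and j: "j \<le> vec.dim C"
  shows "(\<Sum>x\<in>(\<lambda>c. c + v) ` C. (CARD('n) - hamming_weight x) choose j) =
    (\<Sum>x\<in>C. (CARD('n) - hamming_weight x) choose j)"
  unfolding sum_choose_zero_coordinates
proof (rule sum.cong)
  fix T :: "'n set" assume "T \<in> {T. card T = j}"
  then have "card T \<le> vec.dim C" using j by simp
  \<comment> \<open>Interpolating \<open>- v\<close> makes \<open>c + v\<close> a word of the coset
    that vanishes on \<open>T\<close>, so translation by it preserves vanishing on
    \<open>T\<close>.\<close>
  then obtain c where c: "c \<in> C" "\<And>i. i \<in> T \<Longrightarrow> c $ i = (- v) $ i"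
    using mds_interpolation[OF sub wt, of T "- v"] by blast
  have "bij_betw (\<lambda>x. x + (c + v)) {x \<in> C. \<forall>i\<in>T. x $ i = 0}
      {x \<in> (\<lambda>c. c + v) ` C. \<forall>i\<in>T. x $ i = 0}"
  proof (rule bij_betwI[where g = "\<lambda>x. x - (c + v)"])
    show "(\<lambda>x. x + (c + v)) \<in> {x \<in> C. \<forall>i\<in>T. x $ i = 0} \<rightarrow>
        {x \<in> (\<lambda>c. c + v) ` C. \<forall>i\<in>T. x $ i = 0}"
      using c vec.subspace_add[OF sub _ c(1)] by (auto simp flip: add.assoc)
    show "(\<lambda>x. x - (c + v)) \<in> {x \<in> (\<lambda>c. c + v) ` C. \<forall>i\<in>T. x $ i = 0} \<rightarrow>
        {x \<in> C. \<forall>i\<in>T. x $ i = 0}"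
      using c vec.subspace_diff[OF sub _ c(1)] by auto
  qed auto
  then show "card {x \<in> (\<lambda>c. c + v) ` C. \<forall>i\<in>T. x $ i = 0} =
      card {x \<in> C. \<forall>i\<in>T. x $ i = 0}"
    by (simp add: bij_betw_same_card)
qed simp

section \<open>Alternating binomial sums\<close>

text \<open>Once \<open>M choose m\<close> is factored out, a truncated alternating sum of one row
  of Pascal's triangle remains, and it telescopes to a single binomial. At \<open>M = m\<close> the
  truncated \<open>M - m - 1\<close> would give 0 for \<open>m < k\<close>, although the sum is
  1.\<close>

lemma alternating_sum_choose_choose:
  assumes "m \<le> k" "M \<noteq> m"
  shows "(\<Sum>j\<le>k. (-1) ^ (m + j) * real (j choose m) * real (M choose j)) =
    (-1) ^ (m + k) * real (M choose m) * real ((M - m - 1) choose (k - m))"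
proof (cases "M < m")
  case True
  then have "(\<Sum>j\<le>k. (-1) ^ (m + j) * real (j choose m) * real (M choose j)) = 0"
    by (intro sum.neutral) auto
  then show ?thesis using True by simp
next
  case False
  then have M: "m < M" using assms by simp
  have eq: "real (j choose m) * real (M choose j) =
      real (M choose m) * real ((M - m) choose (j - m))" if "m \<le> j" for j
  proof (cases "j \<le> M")
    case True
    then show ?thesis
      using choose_mult[OF that True] by (metis mult.commute of_nat_mult)
  next
    case False
    then have "M choose j = 0" "(M - m) choose (j - m) = 0"
      using that M by (auto intro!: binomial_eq_0)
    then show ?thesis by (simp only: of_nat_0 mult_zero_right)
  qed
  have "(\<Sum>j\<le>k. (-1) ^ (m + j) * real (j choose m) * real (M choose j)) =
      (\<Sum>j\<in>{m..k}. (-1) ^ (m + j) * real (j choose m) * real (M choose j))"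
    by (rule sum.mono_neutral_right) auto
  also have "\<dots> = (\<Sum>j\<in>{m..k}. (-1) ^ (m + j) * (real (M choose m) * real ((M - m) choose (j - m))))"
    by (rule sum.cong) (auto simp: eq mult.assoc)
  also have "\<dots> = (\<Sum>i\<le>k - m. (-1) ^ i * (real (M choose m) * real ((M - m) choose i)))"
    by (rule sum.reindex_bij_witness[of _ "\<lambda>i. i + m" "\<lambda>j. j - m"])
      (use assms in \<open>auto simp: minus_one_power_iff\<close>)
  also have "\<dots> = real (M choose m) * (\<Sum>i\<le>k - m. (real (M - m) gchoose i) * (-1) ^ i)"
    by (simp add: sum_distrib_left binomial_gbinomial mult_ac)
  also have "\<dots> = real (M choose m) * ((-1) ^ (k - m) * (real (M - m) - 1 gchoose (k - m)))"
    by (simp only: gbinomial_sum_lower_neg)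
  also have "real (M - m) - 1 = real (M - m - 1)" using M by simp
  finally show ?thesis
    using assms by (simp add: binomial_gbinomial minus_one_power_iff)
qed

text \<open>Only \<open>j = m\<close> survives; this normalises the coefficient of the isolated
  weight to 1.\<close>

lemma alternating_sum_choose_choose_eq:
  assumes "m \<le> k"
  shows "(\<Sum>j\<le>k. (-1) ^ (m + j) * real (j choose m) * real (m choose j)) = 1"
proof -
  have "(\<Sum>j\<le>k. (-1) ^ (m + j) * real (j choose m) * real (m choose j)) =
      (\<Sum>j\<in>{m}. (-1) ^ (m + j) * real (j choose m) * real (m choose j))"
  proof (rule sum.mono_neutral_right)
    show "\<forall>j\<in>{..k} - {m}. (-1) ^ (m + j) * real (j choose m) * real (m choose j) = 0"
      by (auto simp: not_less_iff_gr_or_eq)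
  qed (use assms in auto)
  then show ?thesis by simp
qed

section \<open>The weight distribution of a coset of weight 2\<close>

lemma sum_by_weight:
  fixes S :: "('a::{zero,finite} ^ 'n) set"
  shows "(\<Sum>x\<in>S. g (hamming_weight x)) = (\<Sum>u\<le>CARD('n). real (weight_count S u) * g u)"
proof -
  have "(\<Sum>x\<in>S. g (hamming_weight x)) =
      (\<Sum>u\<le>CARD('n). \<Sum>x | x \<in> S \<and> hamming_weight x = u. g (hamming_weight x))"
    by (rule sum.group[symmetric]) (auto simp: hamming_weight_le)
  also have "\<dots> = (\<Sum>u\<le>CARD('n). real (weight_count S u) * g u)"
    by (rule sum.cong) (auto simp: weight_count_def)
  finally show ?thesis .
qed

theorem theorem5p1:
  fixes C V :: "('a::{field,finite} ^ 'n) set" and n k d q :: nat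
  assumes "mds_code n k d q C"
    and "d \<ge> 5"
    and "V \<in> cosets C"
    and "coset_weight V = 2"
  shows "(\<forall>w \<in> {0..d - 3} - {2}. weight_count V w = 0) \<and>
    weight_count V 2 = 1 \<and>
    (\<forall>w \<in> {d - 1..n}.
       real (weight_count V w) =
         real (weight_count C w) - Omega 0 w n d + Omega 2 w n d
         + (-1) powi (int w - int d) * real ((n - d + 2) choose (n - w)) * real (weight_count V (d - 2)))"
proof (intro conjI ballI)
  have n: "CARD('n) = n" and sub: "vec.subspace C" and dim: "vec.dim C = k"
    and dist: "has_min_dist C d" and d: "d = n - k + 1"
    using assms(1) by (auto simp: mds_code_def linear_code_def)
  have kn: "k \<le> n"
    using vec.dim_subset[of C UNIV] vec_dim_card[where 'a = 'a and 'n = 'n] by (simp add: n dim)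
  have dn: "d \<le> n"
    using dist hamming_weight_le unfolding has_min_dist_def hamming_dist_eq_weight_diff n[symmetric]
    by metis
  have wt: "d \<le> hamming_weight c" if "c \<in> C" "c \<noteq> 0" for c
    using dist that vec.subspace_0[OF sub] hamming_dist_eq_weight_diff[of c 0]
    unfolding has_min_dist_def by (metis diff_zero)
  obtain v where V: "V = (\<lambda>c. c + v) ` C"
    using assms(3) by (auto simp: cosets_def)
  have V_diff: "x - y \<in> C" if "x \<in> V" "y \<in> V" for x y
    using that by (auto simp: V intro: vec.subspace_diff[OF sub])
  have "0 \<in> C" by (rule vec.subspace_0[OF sub])
  then have "hamming_weight ` V \<noteq> {}" by (auto simp: V)
  then have "coset_weight V \<in> hamming_weight ` V"
    unfolding coset_weight_def by (intro Min_in) auto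
  then obtain e where e: "e \<in> V" "hamming_weight e = 2"
    using assms(4) by auto
  \<comment> \<open>The difference \<open>x - e\<close> is a codeword of weight at most
    \<open>(d - 3) + 2 < d\<close>, hence zero.\<close>
  have light: "x = e" if "x \<in> V" "hamming_weight x \<le> d - 3" for x
  proof (rule ccontr)
    assume "x \<noteq> e"
    then have "d \<le> hamming_weight (x - e)" using wt V_diff that e by simp
    then show False using hamming_weight_diff_le[of x e] that e assms(2) by simp
  qed
  show V_light: "weight_count V w = 0" if "w \<in> {0..d - 3} - {2}" for w
  proof -
    have "{x \<in> V. hamming_weight x = w} = {}" using light e that by auto
    then show ?thesis by (simp add: weight_count_def)
  qed
  \<comment> \<open>Here \<open>d \<ge> 5\<close> enters as \<open>2 \<le> d - 3\<close>.\<close>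
  have "x = e" if "x \<in> V" "hamming_weight x = 2" for x
    by (rule light) (use that assms(2) in auto)
  then have "{x \<in> V. hamming_weight x = 2} = {e}"
    using e by blast
  then show V_2: "weight_count V 2 = 1" by (simp add: weight_count_def)
  have "{x \<in> C. hamming_weight x = 0} = {0}"
    using \<open>0 \<in> C\<close> by (auto simp: hamming_weight_eq_0_iff)
  then have C_0: "weight_count C 0 = 1" by (simp add: weight_count_def)
  have C_light: "weight_count C u = 0" if "0 < u" "u < d" for u
  proof -
    have "{x \<in> C. hamming_weight x = u} = {}"
      using wt that by (force simp: hamming_weight_eq_0_iff[symmetric])
    then show ?thesis by (simp add: weight_count_def)
  qed

  fix w assume w: "w \<in> {d - 1..n}"
  \<comment> \<open>A word of weight \<open>w\<close> has \<open>m\<close> zeros, and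
    \<open>w \<ge> d - 1 = n - k\<close> gives \<open>m \<le> k\<close>.\<close>
  define m where "m = n - w"
  have mk: "m \<le> k" using w d kn by (auto simp: m_def)
  \<comment> \<open>The coefficients come from inverting Pascal's matrix: on \<open>{0..k}\<close>
    the function \<open>h\<close> is the indicator of \<open>m\<close>.\<close>
  define h where "h M = (\<Sum>j\<le>k. (-1) ^ (m + j) * real (j choose m) * real (M choose j))" for M
  have h_same: "h m = 1"
    unfolding h_def using mk by (rule alternating_sum_choose_choose_eq)
  have h_other: "h M = (-1) ^ (m + k) * real (M choose m) * real ((M - m - 1) choose (k - m))"
    if "M \<noteq> m" for M
    unfolding h_def using mk that by (rule alternating_sum_choose_choose)
  have h_0: "h M = 0" if "M \<noteq> m" "M \<le> k" for M
    using that by (cases "M < m") (auto simp: h_other)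
  have sum_h: "(\<Sum>x\<in>S. h (n - hamming_weight x)) =
      (\<Sum>j\<le>k. (-1) ^ (m + j) * real (j choose m) * real (\<Sum>x\<in>S. (n - hamming_weight x) choose j))"
    for S :: "('a ^ 'n) set"
    unfolding h_def by (subst sum.swap) (simp add: sum_distrib_left)
  have "(\<Sum>x\<in>V. (n - hamming_weight x) choose j) = (\<Sum>x\<in>C. (n - hamming_weight x) choose j)"
    if "j \<le> k" for j
    unfolding V n[symmetric]
    by (rule coset_sum_choose[OF sub]) (use wt d that in \<open>auto simp: n dim less_eq_Suc_le\<close>)
  then have "(\<Sum>x\<in>V. h (n - hamming_weight x)) = (\<Sum>x\<in>C. h (n - hamming_weight x))"
    unfolding sum_h by (intro sum.cong) auto
  then have "(\<Sum>u\<le>n. real (weight_count V u) * h (n - u)) =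
      (\<Sum>u\<le>n. real (weight_count C u) * h (n - u))"
    using sum_by_weight[of "\<lambda>u. h (n - u)" V] sum_by_weight[of "\<lambda>u. h (n - u)" C] by (simp add: n)
  \<comment> \<open>Weights up to \<open>d - 3\<close> other than 2 do not occur in
    \<open>V\<close>, and \<open>u \<ge> d - 1\<close> means \<open>n - u \<le> k\<close>, where
    \<open>h\<close> vanishes unless \<open>u = w\<close>. The weight \<open>d - 2\<close> stays
    because it has \<open>k + 1\<close> zeros.\<close>
  moreover have "(\<Sum>u\<le>n. real (weight_count V u) * h (n - u)) =
      (\<Sum>u\<in>{2, d - 2, w}. real (weight_count V u) * h (n - u))"
  proof (rule sum.mono_neutral_right)
    show "\<forall>u\<in>{..n} - {2, d - 2, w}. real (weight_count V u) * h (n - u) = 0"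
    proof
      fix u assume u: "u \<in> {..n} - {2, d - 2, w}"
      show "real (weight_count V u) * h (n - u) = 0"
      proof (cases "u \<le> d - 3")
        case True
        then show ?thesis using u V_light[of u] by simp
      next
        case False
        then have "n - u \<noteq> m" "n - u \<le> k" using u w d by (auto simp: m_def)
        then show ?thesis by (simp add: h_0)
      qed
    qed
  qed (use w assms(2) d kn in auto)
  moreover have "(\<Sum>u\<le>n. real (weight_count C u) * h (n - u)) =
      (\<Sum>u\<in>{0, w}. real (weight_count C u) * h (n - u))"
  proof (rule sum.mono_neutral_right)
    show "\<forall>u\<in>{..n} - {0, w}. real (weight_count C u) * h (n - u) = 0"
    proof
      fix u assume u: "u \<in> {..n} - {0, w}"
      show "real (weight_count C u) * h (n - u) = 0"
      proof (cases "u < d")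
        case True
        then show ?thesis using u C_light[of u] by simp
      next
        case False
        then have "n - u \<noteq> m" "n - u \<le> k" using u w d by (auto simp: m_def)
        then show ?thesis by (simp add: h_0)
      qed
    qed
  qed (use w in auto)
  ultimately have sums: "(\<Sum>u\<in>{2, d - 2, w}. real (weight_count V u) * h (n - u)) =
      (\<Sum>u\<in>{0, w}. real (weight_count C u) * h (n - u))" by simp
  have main: "real (weight_count V w) = real (weight_count C w) + h n - h (n - 2)
      - real (weight_count V (d - 2)) * h (n - (d - 2))"
  proof -
    have "w \<noteq> 0" "w \<noteq> 2" "w \<noteq> d - 2" "2 \<noteq> d - 2" using w assms(2) by auto
    moreover have "h (n - w) = 1" using h_same by (simp add: m_def)
    ultimately have "(\<Sum>u\<in>{2, d - 2, w}. real (weight_count V u) * h (n - u)) =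
          h (n - 2) + (real (weight_count V (d - 2)) * h (n - (d - 2)) + real (weight_count V w))"
        "(\<Sum>u\<in>{0, w}. real (weight_count C u) * h (n - u)) = h n + real (weight_count C w)"
      by (simp_all add: V_2 C_0 del: diff_diff_left)
    then show ?thesis using sums by simp
  qed
  define s :: real where "s = (-1) powi (int w - int d)"
  \<comment> \<open>As \<open>n - k = d - 1\<close>, the parity of \<open>m + k\<close> is that of
    \<open>w + 1 - d\<close>. This exponent is a natural number even for \<open>w = d - 1\<close>;
    the shift by one yields the minus sign.\<close>
  have sgn: "(-1) ^ (m + k) = - s"
  proof -
    have "int w - int d = int (w + 1 - d) - 1" using w by auto
    then have "s = (-1) powi (int (w + 1 - d) - 1)" by (simp only: s_def)
    then have "s = - ((-1) ^ (w + 1 - d))" by (simp add: power_int_diff del: of_nat_diff)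
    moreover have "m + k = w + 1 - d + 2 * m" using w d kn by (auto simp: m_def)
    then have "(-1 :: real) ^ (m + k) = (-1) ^ (w + 1 - d)" by (simp add: power_add power_mult)
    ultimately show ?thesis by simp
  qed
  \<comment> \<open>The zero codeword contributes \<open>h n\<close> and the word \<open>e\<close>
    contributes \<open>h (n - 2)\<close>; symmetry of both binomials turns these into the
    \<open>Omega\<close> terms.\<close>
  have h_n: "h n = - Omega 0 w n d"
  proof -
    have "n choose m = n choose w" "n - m - 1 = w - 1" "k - m = w - 1 - (d - 2)"
      using w d kn assms(2) by (auto simp: m_def binomial_symmetric[of w n])
    moreover have "(w - 1) choose (w - 1 - (d - 2)) = (w - 1) choose (d - 2)"
      using w assms(2) by (intro binomial_symmetric[symmetric]) auto
    moreover have "n \<noteq> m" using w assms(2) by (auto simp: m_def)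
    ultimately show ?thesis by (simp add: h_other sgn Omega_def flip: s_def)
  qed
  have h_n2: "h (n - 2) = - Omega 2 w n d"
  proof -
    have "n - 2 - m = w - 2" "k - m = w - 3 - (d - 4)" "n - 2 - m - 1 = w - 3"
      using w d kn assms(2) by (auto simp: m_def)
    moreover have "(n - 2) choose m = (n - 2) choose (w - 2)"
    proof -
      have "w - 2 \<le> n - 2" "n - 2 - (w - 2) = m" using w assms(2) by (auto simp: m_def)
      then show ?thesis using binomial_symmetric[of "w - 2" "n - 2"] by simp
    qed
    moreover have "(w - 3) choose (w - 3 - (d - 4)) = (w - 3) choose (d - 4)"
      using w assms(2) by (intro binomial_symmetric[symmetric]) auto
    moreover have "n - 2 \<noteq> m" using w assms(2) by (auto simp: m_def)
    moreover have "w - 1 - 2 = w - 3" "d - 2 - 2 = d - 4" by auto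
    ultimately show ?thesis
      by (simp only: h_other sgn Omega_def s_def mult_minus_left not_False_eq_True)
  qed
  \<comment> \<open>Since \<open>n - d + 2 = k + 1\<close>, the second binomial in
    \<open>h_other\<close> becomes \<open>(k - m) choose (k - m) = 1\<close>.\<close>
  have h_nd: "h (n - (d - 2)) = - (s * real ((n - d + 2) choose (n - w)))"
  proof -
    have "n - (d - 2) = n - d + 2" "n - d + 2 \<noteq> m" "n - d + 2 - m - 1 = k - m"
      using w d dn assms(2) by (auto simp: m_def)
    then show ?thesis
      by (simp only: h_other sgn binomial_n_n of_nat_1 mult_1_right mult_minus_left
          not_False_eq_True flip: m_def)
  qed
  show "real (weight_count V w) =
      real (weight_count C w) - Omega 0 w n d + Omega 2 w n d
      + (-1) powi (int w - int d) * real ((n - d + 2) choose (n - w)) * real (weight_count V (d - 2))"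
    unfolding main h_n h_n2 h_nd s_def[symmetric] by argo
qed

end
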